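(* Let $p$ be an odd prime, let $n$ be a positive integer, and let $G=C_{p^n}^3$. Then $$\mathsf D(G)+p^n-1\le \mathsf{s}_{\le \mathsf D(G)-p^n+1}(G)\le \mathsf D(G)+p^n.$$
   Context: $C_m$ denotes the cyclic group of order $m$, written additively, and $C_m^r$ is the direct sum of $r$ copies of $C_m$. For a finite abelian group $G$ (written additively), a sequence over $G$ is a finite unordered list of elements of $G$ with repetition allowed (a finite multiset); its length is its number of terms counted with multiplicity, and it is zero-sum if the sum of its terms (with multiplicity) is $0$. A subsequence is a sub-multiset. The Davenport constant $\mathsf D(G)$ is the smallest integer $\ell$ such that every sequence over $G$ of length $\ell$ has a nonempty zero-sum subsequence. For an integer $t$ with $\exp(G)\le t\le \mathsf D(G)$, where $\exp(G)$ is the exponent of $G$, $\mathsf{s}_{\le t}(G)$ denotes the smallest integer $\ell$ such that every sequence over $G$ of length $\ell$ has a zero-sum subsequence $T$ of length $1\le |T|\le t$. *)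

theory Defs
  imports "HOL-Algebra.Product_Groups" "HOL-Algebra.FiniteProduct" "HOL-Library.Multiset"
    "HOL-Computational_Algebra.Primes"
begin

text \<open>
  The group operation of HOL-Algebra is written multiplicatively, so the zero of an additively
  written group appears as \<open>\<one>\<^bsub>G\<^esub>\<close> and the sum of a sequence as a product.
\<close>

definition cyclic_power :: "nat \<Rightarrow> nat \<Rightarrow> (nat \<Rightarrow> int) monoid" where
  "cyclic_power m r = product_group {..<r} (\<lambda>_. integer_mod_group m)"

definition sequence_over :: "('a, 'b) monoid_scheme \<Rightarrow> 'a multiset \<Rightarrow> bool" where
  "sequence_over G S \<longleftrightarrow> set_mset S \<subseteq> carrier G"

definition seq_sum :: "('a, 'b) monoid_scheme \<Rightarrow> 'a multiset \<Rightarrow> 'a" where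
  "seq_sum G S = (\<Otimes>\<^bsub>G\<^esub>g\<in>set_mset S. g [^]\<^bsub>G\<^esub> count S g)"

definition zero_sum :: "('a, 'b) monoid_scheme \<Rightarrow> 'a multiset \<Rightarrow> bool" where
  "zero_sum G S \<longleftrightarrow> seq_sum G S = \<one>\<^bsub>G\<^esub>"

definition davenport :: "('a, 'b) monoid_scheme \<Rightarrow> nat" where
  "davenport G = (LEAST l. \<forall>S. sequence_over G S \<and> size S = l \<longrightarrow>
     (\<exists>T. T \<subseteq># S \<and> T \<noteq> {#} \<and> zero_sum G T))"

text \<open>
  \<open>short_zero_sum t G\<close> is $\mathsf{s}_{\le t}(G)$. It is meaningful when \<open>t\<close> is at least the
  exponent of \<open>G\<close>; for smaller \<open>t\<close> no such length need exist and \<open>LEAST\<close> is then unspecified.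
\<close>

definition short_zero_sum :: "nat \<Rightarrow> ('a, 'b) monoid_scheme \<Rightarrow> nat" where
  "short_zero_sum t G = (LEAST l. \<forall>S. sequence_over G S \<and> size S = l \<longrightarrow>
     (\<exists>T. T \<subseteq># S \<and> 1 \<le> size T \<and> size T \<le> t \<and> zero_sum G T))"

end

theory Submission
  imports Defs "HOL-Number_Theory.Cong"
begin

text \<open>
  Write \<open>q = p ^ n\<close>. Then $\mathsf D(G) = 3q - 2$, and a short zero-sum subsequence is one of length
  at most \<open>2 * q - 1\<close>.

  Modulo \<open>p\<close> the indicator of \<open>q dvd x\<close> is the polynomial $\binom{x + q - 1}{q - 1}$ of degree
  \<open>q - 1\<close>, so being zero-sum in $C_q^r$ is a polynomial condition of degree \<open>r * (q - 1)\<close>. Since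
  an alternating sum over all subsets of an index set kills polynomials of degree below its
  cardinality, $\sum_T (-1)^{|T|} \binom{|T|}{d} \equiv 0$ over the zero-sum subsequences \<open>T\<close> of any
  sequence longer than \<open>r * (q - 1) + d\<close>. For \<open>d = 0\<close> this bounds the Davenport constant. If a
  sequence of length \<open>4 * q - 2\<close> had no short zero-sum subsequence, every nonempty zero-sum \<open>T\<close>
  would satisfy $2q \le |T| \le 3q - 2$, as a longer one would split into two parts one of which is short.
  Then $\binom{|T|}{q} \equiv 2$, and comparing \<open>d = 0\<close> with \<open>d = q\<close> gives \<open>p dvd 2\<close>.

  For the lower bounds, repeat each of $e_1, e_2, e_3$ and $e_1 + e_2 - e_3$ exactly \<open>q - 1\<close> times:
  all nonempty zero-sum subsequences involve the last element and have length \<open>2 * q\<close>.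
\<close>

section \<open>Finite differences and the degree of functions on multisets\<close>

text \<open>Having degree less than \<open>k\<close> means being annihilated by all \<open>k\<close>-fold differences.\<close>

fun degree_less :: "nat \<Rightarrow> ('a multiset \<Rightarrow> int) \<Rightarrow> bool" where
  "degree_less 0 F \<longleftrightarrow> F = (\<lambda>_. 0)"
| "degree_less (Suc k) F \<longleftrightarrow> (\<forall>g. degree_less k (\<lambda>T. F (add_mset g T) - F T))"

lemma degree_less_zero [simp]: "degree_less k (\<lambda>_. 0)"
  by (induction k) auto

lemma degree_less_const: "degree_less (Suc 0) (\<lambda>_. c)"
  by simp

lemma degree_less_Suc: "degree_less k F \<Longrightarrow> degree_less (Suc k) F"
  by (induction k arbitrary: F) auto

lemma degree_less_mono: "degree_less k F \<Longrightarrow> k \<le> l \<Longrightarrow> degree_less l F"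
  by (rule dec_induct[of k l "\<lambda>l. degree_less l F"]) (auto intro: degree_less_Suc simp del: degree_less.simps)

lemma degree_less_add:
  "degree_less k F \<Longrightarrow> degree_less k H \<Longrightarrow> degree_less k (\<lambda>T. F T + H T)"
proof (induction k arbitrary: F H)
  case (Suc k)
  show ?case
    unfolding degree_less.simps
  proof
    fix g
    have "degree_less k (\<lambda>T. (F (add_mset g T) - F T) + (H (add_mset g T) - H T))"
      using Suc by simp
    then show "degree_less k (\<lambda>T. F (add_mset g T) + H (add_mset g T) - (F T + H T))"
      by (simp add: algebra_simps)
  qed
qed auto

lemma degree_less_sum:
  "finite A \<Longrightarrow> (\<And>i. i \<in> A \<Longrightarrow> degree_less k (F i)) \<Longrightarrow> degree_less k (\<lambda>T. \<Sum>i\<in>A. F i T)"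
  by (induction A rule: finite_induct) (auto intro: degree_less_add)

lemma degree_less_scale: "degree_less k F \<Longrightarrow> degree_less k (\<lambda>T. c * F T)"
proof (induction k arbitrary: F)
  case (Suc k)
  then have "degree_less k (\<lambda>T. c * (F (add_mset g T) - F T))" for g
    by simp
  then show ?case by (simp add: algebra_simps)
qed auto

text \<open>Discrete Leibniz rule: \<Delta>(FH) = \<Delta>F (H + \<Delta>H) + F \<Delta>H, and each
  summand has a factor of smaller degree, or one that vanishes. The successors encode degrees at
  most \<open>k\<close> and \<open>l\<close>.\<close>

lemma degree_less_mult:
  "degree_less (Suc k) F \<Longrightarrow> degree_less (Suc l) H \<Longrightarrow> degree_less (Suc (k + l)) (\<lambda>T. F T * H T)"
proof (induction "k + l" arbitrary: k l F H rule: less_induct)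
  case less
  define \<Delta> where "\<Delta> = (\<lambda>g (F :: 'a multiset \<Rightarrow> int) T. F (add_mset g T) - F T)"
  have "degree_less (k + l) (\<lambda>T. F (add_mset g T) * H (add_mset g T) - F T * H T)" for g
  proof -
    have dF: "degree_less k (\<Delta> g F)" and dH: "degree_less l (\<Delta> g H)"
      using less.prems by (auto simp: \<Delta>_def)
    have H': "degree_less (Suc l) (\<lambda>T. H T + \<Delta> g H T)"
      using degree_less_add[OF less.prems(2) degree_less_Suc[OF dH]] .
    have 1: "degree_less (k + l) (\<lambda>T. \<Delta> g F T * (H T + \<Delta> g H T))"
    proof (cases k)
      case 0
      then show ?thesis using dF by simp
    next
      case (Suc k')
      then show ?thesis using less.hyps[of k' l, OF _ _ H'] dF by simp
    qed
    have 2: "degree_less (k + l) (\<lambda>T. F T * \<Delta> g H T)"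
    proof (cases l)
      case 0
      then show ?thesis using dH by simp
    next
      case (Suc l')
      then show ?thesis using less.hyps[of k l', OF _ less.prems(1)] dH by simp
    qed
    show ?thesis
      using degree_less_add[OF 1 2] by (simp add: \<Delta>_def algebra_simps)
  qed
  then show ?case by simp
qed

lemma degree_less_prod:
  "finite A \<Longrightarrow> (\<And>i. i \<in> A \<Longrightarrow> degree_less (Suc k) (F i)) \<Longrightarrow>
    degree_less (Suc (card A * k)) (\<lambda>T. \<Prod>i\<in>A. F i T)"
proof (induction A rule: finite_induct)
  case (insert i A)
  then show ?case
    using degree_less_mult[of k "F i" "card A * k" "\<lambda>T. \<Prod>i\<in>A. F i T"] by simp
qed (simp add: degree_less_const)

text \<open>By Vandermonde, adding \<open>g\<close> changes the binomial coefficient by a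
  combination of lower ones whose coefficients do not depend on \<open>T\<close>.\<close>

lemma degree_less_binomial:
  fixes \<phi> :: "'a multiset \<Rightarrow> nat"
  assumes "\<And>g T. \<phi> (add_mset g T) = w g + \<phi> T"
  shows "degree_less (Suc m) (\<lambda>T. int ((c + \<phi> T) choose m))"
proof (induction m rule: less_induct)
  case (less m)
  have "degree_less m (\<lambda>T. int ((c + \<phi> (add_mset g T)) choose m) - int ((c + \<phi> T) choose m))" for g
  proof -
    have "int ((c + \<phi> (add_mset g T)) choose m) - int ((c + \<phi> T) choose m) =
        (\<Sum>k<m. int (w g choose (m - k)) * int ((c + \<phi> T) choose k))" for T
    proof -
      have "(c + \<phi> (add_mset g T)) choose m = (\<Sum>k\<le>m. ((c + \<phi> T) choose k) * (w g choose (m - k)))"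
        unfolding assms vandermonde by (simp add: add_ac)
      also have "\<dots> = ((c + \<phi> T) choose m) + (\<Sum>k<m. (w g choose (m - k)) * ((c + \<phi> T) choose k))"
        by (simp add: lessThan_Suc_atMost[symmetric] mult.commute)
      finally show ?thesis by simp
    qed
    moreover have "degree_less m (\<lambda>T. \<Sum>k<m. int (w g choose (m - k)) * int ((c + \<phi> T) choose k))"
      by (intro degree_less_sum degree_less_scale degree_less_mono[OF less]) auto
    ultimately show ?thesis by simp
  qed
  then show ?case by simp
qed

text \<open>Pairing \<open>U\<close> with \<open>insert i U\<close> trades the index
  \<open>i\<close> for one difference in direction \<open>a i\<close>, so in the end
  \<open>card I\<close> differences are applied to \<open>F\<close>. Index sets, unlike
  sub-multisets, count repeated terms separately.\<close>

lemma alternating_sum_eq_0: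
  assumes "finite I" "degree_less (card I) F"
  shows "(\<Sum>U\<in>Pow I. (-1) ^ card U * F (image_mset a (mset_set U))) = 0"
  using assms
proof (induction I arbitrary: F rule: finite_induct)
  case (insert i I)
  define f where "f U = (-1) ^ card U * F (image_mset a (mset_set U))" for U
  have inj: "inj_on (insert i) (Pow I)"
    using insert.hyps by (auto simp: inj_on_def)
  have disj: "Pow I \<inter> insert i ` Pow I = {}"
    using insert.hyps by auto
  have f': "f U + f (insert i U) =
      - ((-1) ^ card U * (F (add_mset (a i) (image_mset a (mset_set U))) - F (image_mset a (mset_set U))))"
    if "U \<in> Pow I" for U
  proof -
    have "finite U" "i \<notin> U"
      using that insert.hyps finite_subset by auto
    then show ?thesis by (simp add: f_def algebra_simps)
  qed
  have "(\<Sum>U\<in>Pow (insert i I). f U) = (\<Sum>U\<in>Pow I. f U + f (insert i U))"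
    using insert.hyps by (simp add: Pow_insert sum.union_disjoint disj sum.reindex[OF inj] sum.distrib)
  also have "\<dots> = 0"
    using insert.IH[of "\<lambda>T. F (add_mset (a i) T) - F T" for i] insert.prems insert.hyps by (simp add: f' sum_negf)
  finally show ?case by (simp add: f_def)
qed auto

section \<open>Binomial coefficients modulo a prime\<close>

text \<open>The number \<open>k * (p ^ n choose k)\<close> is a multiple of \<open>p ^ n\<close>;
  were the binomial coefficient prime to \<open>p\<close>, then \<open>p ^ n\<close> would divide
  the smaller number \<open>k\<close>.\<close>

lemma prime_dvd_prime_power_choose:
  fixes p :: nat
  assumes "prime p" "0 < k" "k < p ^ n"
  shows "p dvd (p ^ n choose k)"
proof (rule ccontr)
  assume "\<not> p dvd (p ^ n choose k)"
  then have "coprime (p ^ n) (p ^ n choose k)"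
    by (meson assms(1) coprime_power_left_iff prime_imp_coprime)
  moreover have "p ^ n dvd k * (p ^ n choose k)"
    using times_binomial_minus1_eq[OF assms(2)] by simp
  ultimately have "p ^ n dvd k"
    by (simp add: coprime_dvd_mult_left_iff)
  then show False
    using assms by (simp add: nat_dvd_not_less)
qed

text \<open>In Vandermonde's sum only the term \<open>k = 0\<close> survives modulo
  \<open>p\<close>.\<close>

lemma binomial_add_prime_power_cong:
  fixes p :: nat
  assumes "prime p" "m < p ^ n"
  shows "[(p ^ n + x) choose m = x choose m] (mod p)"
proof -
  have "[(\<Sum>k\<in>{..m} - {0}. (p ^ n choose k) * (x choose (m - k))) = 0] (mod p)"
    using assms by (auto simp: cong_0_iff intro!: dvd_sum dvd_mult2 prime_dvd_prime_power_choose)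
  moreover have "(\<Sum>k\<le>m. (p ^ n choose k) * (x choose (m - k))) =
      (x choose m) + (\<Sum>k\<in>{..m} - {0}. (p ^ n choose k) * (x choose (m - k)))"
    by (simp add: sum.remove[of "{..m}" 0])
  ultimately show ?thesis
    by (metis vandermonde cong_add_lcancel_0_nat)
qed

text \<open>Here the term \<open>k = p ^ n\<close> of Vandermonde's sum survives as well and
  contributes 1.\<close>

lemma binomial_add_prime_power_cong':
  fixes p :: nat
  assumes "prime p"
  shows "[(p ^ n + x) choose p ^ n = (x choose p ^ n) + 1] (mod p)"
proof -
  have q: "p ^ n > 0" using assms prime_gt_0_nat by simp
  have "[(\<Sum>k\<in>{..<p ^ n} - {0}. (p ^ n choose k) * (x choose (p ^ n - k))) = 0] (mod p)"
    using assms by (auto simp: cong_0_iff intro!: dvd_sum dvd_mult2 prime_dvd_prime_power_choose)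
  moreover have "(\<Sum>k\<le>p ^ n. (p ^ n choose k) * (x choose (p ^ n - k))) =
      (x choose p ^ n) + 1 + (\<Sum>k\<in>{..<p ^ n} - {0}. (p ^ n choose k) * (x choose (p ^ n - k)))"
    using q by (simp add: lessThan_Suc_atMost[symmetric] sum.remove[of "{..<p ^ n}" 0])
  ultimately show ?thesis
    by (metis vandermonde cong_add_lcancel_0_nat)
qed

text \<open>Both sides have period \<open>p ^ n\<close> in \<open>x\<close> modulo \<open>p\<close>.
  For \<open>0 < x < p ^ n\<close>, reading the upper entry as \<open>p ^ n + (x - 1)\<close>
  reduces it to \<open>x - 1\<close>, which is below the lower entry.\<close>

lemma binomial_indicator_cong:
  fixes p :: nat
  assumes "prime p"
  shows "[(p ^ n - 1 + x) choose (p ^ n - 1) = of_bool (p ^ n dvd x)] (mod p)"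
proof (induction x rule: less_induct)
  case (less x)
  have q: "p ^ n > 0" using assms prime_gt_0_nat by simp
  consider "x = 0" | "0 < x" "x < p ^ n" | "p ^ n \<le> x" by linarith
  then show ?case
  proof cases
    case 2
    have "[(p ^ n + (x - 1)) choose (p ^ n - 1) = (x - 1) choose (p ^ n - 1)] (mod p)"
      using q by (intro binomial_add_prime_power_cong assms) auto
    then show ?thesis
      using 2 by (simp add: binomial_eq_0 nat_dvd_not_less)
  next
    case 3
    then obtain y where y: "x = p ^ n + y"
      using le_Suc_ex by blast
    have "[(p ^ n + (p ^ n - 1 + y)) choose (p ^ n - 1) = (p ^ n - 1 + y) choose (p ^ n - 1)] (mod p)"
      using q by (intro binomial_add_prime_power_cong assms) auto
    also have "[(p ^ n - 1 + y) choose (p ^ n - 1) = of_bool (p ^ n dvd y)] (mod p)"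
      by (rule less) (use y q in linarith)
    finally show ?thesis
      by (simp add: y add.left_commute)
  qed auto
qed

text \<open>A case of Lucas' theorem: both sides vanish below \<open>p ^ n\<close>, and adding
  \<open>p ^ n\<close> to \<open>x\<close> raises both by 1.\<close>

lemma binomial_prime_power_cong_div:
  fixes p :: nat
  assumes "prime p"
  shows "[x choose p ^ n = x div p ^ n] (mod p)"
proof (induction x rule: less_induct)
  case (less x)
  have q: "p ^ n > 0" using assms prime_gt_0_nat by simp
  show ?case
  proof (cases "x < p ^ n")
    case False
    then obtain y where y: "x = p ^ n + y"
      by (metis le_Suc_ex not_less)
    have "[(p ^ n + y) choose p ^ n = (y choose p ^ n) + 1] (mod p)"
      using assms by (rule binomial_add_prime_power_cong')
    also have "[(y choose p ^ n) + 1 = y div p ^ n + 1] (mod p)"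
      using less[of y] y q by (intro cong_add) auto
    finally show ?thesis
      using q by (simp add: y)
  qed (simp add: binomial_eq_0)
qed

section \<open>Signed counts of zero-sum index sets\<close>

text \<open>The product of \<open>r\<close> indicator polynomials and \<open>size T choose d\<close>
  has degree at most \<open>r * (p ^ n - 1) + d\<close>, so its alternating sum is 0, while modulo
  \<open>p\<close> only the sets in \<open>Z\<close> contribute to that sum.\<close>

lemma prime_dvd_signed_zero_sum_count:
  fixes w :: "nat \<Rightarrow> 'a \<Rightarrow> nat" and a :: "'i \<Rightarrow> 'a" and p n r d :: nat
  assumes "prime p" "finite I" "r * (p ^ n - 1) + d < card I"
  defines "Z \<equiv> {U \<in> Pow I. \<forall>j<r. p ^ n dvd (\<Sum>g\<in>#image_mset a (mset_set U). w j g)}"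
  shows "int p dvd (\<Sum>U\<in>Z. (-1) ^ card U * int (card U choose d))"
proof -
  define q where "q = p ^ n"
  define N where "N j T = (\<Sum>g\<in>#T. w j g)" for j T
  \<comment> \<open>The summand 0 gives the last factor the shape \<open>c + \<phi> T\<close> of
    \<open>degree_less_binomial\<close>.\<close>
  define F where "F T = (\<Prod>j<r. int ((q - 1 + N j T) choose (q - 1))) * int ((0 + size T) choose d)" for T
  have "degree_less (Suc (card {..<r} * (q - 1))) (\<lambda>T. \<Prod>j<r. int ((q - 1 + N j T) choose (q - 1)))"
    by (intro degree_less_prod degree_less_binomial[where w = "w _"]) (auto simp: N_def)
  then have "degree_less (Suc (r * (q - 1) + d)) F"
    unfolding F_def by (intro degree_less_mult degree_less_binomial[where w = "\<lambda>_. 1"]) auto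
  then have "degree_less (card I) F"
    by (rule degree_less_mono) (use assms(3) in \<open>simp add: q_def\<close>)
  then have 0: "(\<Sum>U\<in>Pow I. (-1) ^ card U * F (image_mset a (mset_set U))) = 0"
    by (intro alternating_sum_eq_0 assms)
  have F: "[F T = of_bool (\<forall>j<r. q dvd N j T) * int (size T choose d)] (mod int p)" for T
  proof -
    have "[(\<Prod>j<r. int ((q - 1 + N j T) choose (q - 1))) = (\<Prod>j<r. int (of_bool (q dvd N j T)))] (mod int p)"
      unfolding q_def cong_int_iff by (intro cong_prod) (simp only: cong_int_iff binomial_indicator_cong[OF assms(1)])
    also have "(\<Prod>j<r. int (of_bool (q dvd N j T))) = of_bool (\<forall>j<r. q dvd N j T)"
      by (auto simp: prod_zero_iff intro: prod.neutral)
    finally show ?thesis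
      unfolding F_def by (intro cong_mult) auto
  qed
  have "[(\<Sum>U\<in>Pow I. (-1) ^ card U * F (image_mset a (mset_set U))) = (\<Sum>U\<in>Pow I. (-1) ^ card U *
      (of_bool (\<forall>j<r. q dvd N j (image_mset a (mset_set U))) * int (card U choose d)))] (mod int p)"
    using F[of "image_mset a (mset_set U)" for U] by (intro cong_sum cong_mult cong_refl) simp
  also have "(\<Sum>U\<in>Pow I. (-1) ^ card U *
      (of_bool (\<forall>j<r. q dvd N j (image_mset a (mset_set U))) * int (card U choose d))) =
      (\<Sum>U\<in>Z. (-1) ^ card U * int (card U choose d))"
    unfolding Z_def using assms(2)
    by (intro sum.mono_neutral_cong_right) (auto simp: q_def N_def)
  finally show ?thesis
    using 0 by (metis cong_0_iff cong_sym)
qed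


section \<open>Sums in \<open>cyclic_power m r\<close>, computed coordinatewise\<close>

lemma carrier_cyclic_power:
  "m > 0 \<Longrightarrow> carrier (cyclic_power m r) = (\<Pi>\<^sub>E j\<in>{..<r}. {0..<int m})"
  by (simp add: cyclic_power_def carrier_integer_mod_group)

lemma mult_cyclic_power: "x \<otimes>\<^bsub>cyclic_power m r\<^esub> y = (\<lambda>j\<in>{..<r}. (x j + y j) mod int m)"
  by (simp add: cyclic_power_def)

lemma one_cyclic_power: "\<one>\<^bsub>cyclic_power m r\<^esub> = (\<lambda>j\<in>{..<r}. 0)"
  by (simp add: cyclic_power_def)

lemma comm_group_cyclic_power: "comm_group (cyclic_power m r)"
proof (rule group.group_comm_groupI)
  show "group (cyclic_power m r)"
    by (simp add: cyclic_power_def)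
qed (simp add: mult_cyclic_power add.commute)

lemma pow_cyclic_power:
  "g [^]\<^bsub>cyclic_power m r\<^esub> (k :: nat) = (\<lambda>j\<in>{..<r}. (int k * g j) mod int m)"
proof (induction k)
  case (Suc k)
  then show ?case
    by (auto simp: mult_cyclic_power fun_eq_iff algebra_simps mod_simps)
qed (simp add: one_cyclic_power)

lemma finprod_cyclic_power:
  assumes "finite A" "f \<in> A \<rightarrow> carrier (cyclic_power m r)"
  shows "(\<Otimes>\<^bsub>cyclic_power m r\<^esub>x\<in>A. f x) = (\<lambda>j\<in>{..<r}. (\<Sum>x\<in>A. f x j) mod int m)"
proof -
  interpret comm_group "cyclic_power m r"
    by (rule comm_group_cyclic_power)
  show ?thesis
    using assms
  proof (induction A rule: finite_induct)
    case (insert x A)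
    then have "(\<Otimes>\<^bsub>cyclic_power m r\<^esub>x\<in>insert x A. f x) =
        f x \<otimes>\<^bsub>cyclic_power m r\<^esub> (\<Otimes>\<^bsub>cyclic_power m r\<^esub>x\<in>A. f x)"
      by (intro finprod_insert) auto
    with insert show ?case
      by (auto simp: mult_cyclic_power fun_eq_iff mod_simps)
  qed (simp add: one_cyclic_power)
qed

text \<open>Since \<open>A\<close> may exceed the support, this serves both for
  \<open>set_mset T\<close> and for the fixed four elements of the extremal sequence.\<close>

lemma sum_image_mset_eq_sum_count:
  fixes f :: "'a \<Rightarrow> int"
  assumes "finite A" "set_mset T \<subseteq> A"
  shows "(\<Sum>g\<in>#T. f g) = (\<Sum>g\<in>A. int (count T g) * f g)"
  using assms(2)
proof (induction T)
  case (add x T)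
  have "(\<Sum>g\<in>A. int (count (add_mset x T) g) * f g) =
      (\<Sum>g\<in>A. int (count T g) * f g + (if g = x then f g else 0))"
    by (intro sum.cong) (auto simp: algebra_simps)
  also have "\<dots> = (\<Sum>g\<in>A. int (count T g) * f g) + f x"
    using add.prems assms(1) by (simp add: sum.distrib)
  finally show ?case using add by simp
qed simp

lemma zero_sum_cyclic_power_iff:
  assumes "sequence_over (cyclic_power m r) T"
  shows "zero_sum (cyclic_power m r) T \<longleftrightarrow> (\<forall>j<r. int m dvd (\<Sum>g\<in>#T. g j))"
proof -
  interpret comm_group "cyclic_power m r"
    by (rule comm_group_cyclic_power)
  have "seq_sum (cyclic_power m r) T =
      (\<lambda>j\<in>{..<r}. (\<Sum>g\<in>set_mset T. (g [^]\<^bsub>cyclic_power m r\<^esub> count T g) j) mod int m)"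
    unfolding seq_sum_def using assms by (intro finprod_cyclic_power) (auto simp: sequence_over_def)
  also have "\<dots> = (\<lambda>j\<in>{..<r}. (\<Sum>g\<in>#T. g j) mod int m)"
    by (auto simp: fun_eq_iff pow_cyclic_power mod_sum_eq sum_image_mset_eq_sum_count[OF finite_set_mset subset_refl])
  finally show ?thesis
    unfolding zero_sum_def one_cyclic_power by (auto simp: fun_eq_iff dvd_eq_mod_eq_0)
qed

text \<open>The indicator binomials take natural arguments; coordinates lie in
  \<open>{0..<int m}\<close>, so \<open>nat\<close> loses nothing.\<close>

lemma zero_sum_cyclic_power_iff_nat:
  assumes "m > 0" "sequence_over (cyclic_power m r) T"
  shows "zero_sum (cyclic_power m r) T \<longleftrightarrow> (\<forall>j<r. m dvd (\<Sum>g\<in>#T. nat (g j)))"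
proof -
  have "int (\<Sum>g\<in>#T. nat (g j)) = (\<Sum>g\<in>#T. g j)" if "j < r" for j
  proof -
    have "(\<Sum>g\<in>#T. int (nat (g j))) = (\<Sum>g\<in>#T. g j)"
      using assms that
      by (intro arg_cong[where f = sum_mset] image_mset_cong)
        (auto simp: sequence_over_def carrier_cyclic_power PiE_iff subset_iff)
    then show ?thesis by (simp add: of_nat_sum_mset multiset.map_comp comp_def)
  qed
  then show ?thesis
    unfolding zero_sum_cyclic_power_iff[OF assms(2)] by (metis of_nat_dvd_iff)
qed

lemma zero_sum_cyclic_power_diff:
  assumes "sequence_over (cyclic_power m r) S" "T \<subseteq># S"
    "zero_sum (cyclic_power m r) S" "zero_sum (cyclic_power m r) T"
  shows "zero_sum (cyclic_power m r) (S - T)"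
proof -
  obtain R where S: "S = T + R"
    using assms(2) by (metis subset_mset.add_diff_inverse)
  then have "sequence_over (cyclic_power m r) T" "sequence_over (cyclic_power m r) R"
    using assms(1) by (auto simp: sequence_over_def)
  then show ?thesis
    using assms by (auto simp: S zero_sum_cyclic_power_iff dvd_add_right_iff)
qed

section \<open>Existence of zero-sum subsequences: the upper bounds\<close>

lemma multiset_indexing:
  obtains I :: "nat set" and a where "finite I" "image_mset a (mset_set I) = S"
proof -
  obtain xs where "mset xs = S"
    using ex_mset by blast
  then have "image_mset ((!) xs) (mset_set {0..<length xs}) = S"
    by (metis map_nth mset_map mset_upt)
  then show ?thesis
    using that by blast
qed

lemma sub_multiset_of_size:
  assumes "k \<le> size S"
  obtains T where "T \<subseteq># S" "size T = k"
proof -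
  obtain xs where "mset xs = S"
    using ex_mset by blast
  then show ?thesis
    using assms that[of "mset (take k xs)"]
    by (metis append_take_drop_id length_take min.absorb2 mset_append mset_subset_eq_add_left size_mset)
qed

text \<open>Otherwise the empty index set is the only zero-sum one, and the signed count with
  \<open>d = 0\<close> equals 1, which \<open>p\<close> does not divide.\<close>

lemma zero_sum_subsequence_exists:
  fixes p n r :: nat
  assumes "prime p" and S: "sequence_over (cyclic_power (p ^ n) r) S" and "r * (p ^ n - 1) < size S"
  shows "\<exists>T. T \<subseteq># S \<and> T \<noteq> {#} \<and> zero_sum (cyclic_power (p ^ n) r) T"
proof (rule ccontr)
  assume none: "\<not> ?thesis"
  obtain I :: "nat set" and a where I: "finite I" "image_mset a (mset_set I) = S"
    by (rule multiset_indexing)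
  have q: "p ^ n > 0"
    using assms(1) prime_gt_0_nat by simp
  define Z where "Z = {U \<in> Pow I. \<forall>j<r. p ^ n dvd (\<Sum>g\<in>#image_mset a (mset_set U). nat (g j))}"
  have "U = {}" if "U \<in> Z" for U
  proof (rule ccontr)
    assume "U \<noteq> {}"
    have U: "finite U" "image_mset a (mset_set U) \<subseteq># S"
      using that I finite_subset by (auto simp: Z_def subset_imp_msubset_mset_set image_mset_subseteq_mono)
    then have "sequence_over (cyclic_power (p ^ n) r) (image_mset a (mset_set U))"
      using S set_mset_mono unfolding sequence_over_def by blast
    then have "zero_sum (cyclic_power (p ^ n) r) (image_mset a (mset_set U))"
      using that q by (simp only: zero_sum_cyclic_power_iff_nat) (simp add: Z_def)
    then show False
      using none U \<open>U \<noteq> {}\<close> by (auto simp: mset_set_empty_iff)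
  qed
  then have "Z = {{}}"
    by (auto simp: Z_def)
  have "r * (p ^ n - 1) + 0 < card I"
    using assms(3) I by auto
  then have "int p dvd (\<Sum>U\<in>Z. (-1) ^ card U * int (card U choose 0))"
    unfolding Z_def by (intro prime_dvd_signed_zero_sum_count assms I)
  then show False
    using \<open>Z = {{}}\<close> assms(1) by (simp add: prime_nat_iff)
qed

lemma short_zero_sum_subsequence_exists:
  fixes p n :: nat
  defines "G \<equiv> cyclic_power (p ^ n) 3"
  assumes "prime p" "odd p" and S: "sequence_over G S" and size: "size S = 4 * p ^ n - 2"
  shows "\<exists>T. T \<subseteq># S \<and> 1 \<le> size T \<and> size T \<le> 2 * p ^ n - 1 \<and> zero_sum G T"
proof (rule ccontr)
  assume none: "\<not> ?thesis"
  define q where "q = p ^ n"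
  have q: "q > 0"
    using assms(2) prime_gt_0_nat by (simp add: q_def)
  have long: "2 * q \<le> size T" if "T \<subseteq># S" "T \<noteq> {#}" "zero_sum G T" for T
    using none that q by (force simp: q_def not_le Suc_le_eq)
  \<comment> \<open>\<open>R\<close> omits at least one term of \<open>T\<close>, so the zero-sum
    \<open>V\<close> inside \<open>R\<close> is a proper part of \<open>T\<close>. Then
    \<open>V\<close> and \<open>T - V\<close> both have length at least \<open>2 * q\<close>, too
    much for a sequence of length \<open>4 * q - 2\<close>.\<close>
  have minimal: "size T \<le> 3 * q - 2" if T: "T \<subseteq># S" "zero_sum G T" for T
  proof (rule ccontr)
    assume "\<not> size T \<le> 3 * q - 2"
    then have "3 * (q - 1) + 1 \<le> size T - 1" "T \<noteq> {#}"
      using q by auto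
    then obtain R where R: "R \<subseteq># T" "size R = 3 * (q - 1) + 1"
      using sub_multiset_of_size[of "3 * (q - 1) + 1" T] by force
    have seq: "sequence_over G T"
      using S T set_mset_mono unfolding sequence_over_def by blast
    then have "sequence_over G R"
      using R set_mset_mono unfolding sequence_over_def by blast
    then obtain V where V: "V \<subseteq># R" "V \<noteq> {#}" "zero_sum G V"
      using zero_sum_subsequence_exists[of p n 3 R] R assms(2) by (auto simp: G_def q_def)
    have VT: "V \<subseteq># T"
      using V R by (meson subset_mset.trans)
    have "zero_sum G (T - V)"
      using zero_sum_cyclic_power_diff seq T V VT by (simp add: G_def)
    moreover have "size V < size T"
      using size_mset_mono[OF V(1)] R \<open>3 * (q - 1) + 1 \<le> size T - 1\<close> by linarith
    then have "T - V \<noteq> {#}"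
      using VT by (metis size_Diff_submset size_empty zero_less_diff less_irrefl)
    ultimately have "2 * q \<le> size (T - V)"
      using long[of "T - V"] T by (meson diff_subset_eq_self subset_mset.trans)
    moreover have "2 * q \<le> size V"
      using long[of V] V VT T by (meson subset_mset.trans)
    moreover have "size (T - V) + size V = size T"
      using VT by (metis size_union subset_mset.diff_add)
    moreover have "size T \<le> 4 * q - 2"
      using size_mset_mono[OF T(1)] size by (simp add: q_def)
    ultimately show False
      using q by linarith
  qed
  obtain I :: "nat set" and a where I: "finite I" "image_mset a (mset_set I) = S"
    by (rule multiset_indexing)
  have cardI: "card I = 4 * q - 2"
    using I size by (auto simp: q_def)
  define Z where "Z = {U \<in> Pow I. \<forall>j<3. p ^ n dvd (\<Sum>g\<in>#image_mset a (mset_set U). nat (g j))}"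
  have "finite Z" "{} \<in> Z"
    using I by (auto simp: Z_def)
  have card_Z: "2 * q \<le> card U \<and> card U \<le> 3 * q - 2" if "U \<in> Z - {{}}" for U
  proof -
    have U: "finite U" "image_mset a (mset_set U) \<subseteq># S"
      using that I finite_subset by (auto simp: Z_def subset_imp_msubset_mset_set image_mset_subseteq_mono)
    then have "sequence_over G (image_mset a (mset_set U))"
      using S set_mset_mono unfolding sequence_over_def by blast
    then have "zero_sum G (image_mset a (mset_set U))"
      using that q by (simp only: G_def q_def zero_sum_cyclic_power_iff_nat) (simp add: Z_def)
    then show ?thesis
      using long minimal U that by (fastforce simp: mset_set_empty_iff)
  qed
  have choose_Z: "[int (card U choose q) = 2] (mod int p)" if "U \<in> Z - {{}}" for U
  proof -
    have "card U div q = 2"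
      using card_Z[OF that] q by (intro div_nat_eqI) auto
    then have "[card U choose q = 2] (mod p)"
      using binomial_prime_power_cong_div[OF assms(2), of "card U" n] by (simp add: q_def)
    then show ?thesis
      by (metis cong_int_iff of_nat_numeral)
  qed
  \<comment> \<open>\<open>A\<close> leaves out the empty set, which contributes 1 to the count with
    \<open>d = 0\<close>, but 0 to the count with \<open>d = q\<close>.\<close>
  define A where "A = (\<Sum>U\<in>Z - {{}}. (-1) ^ card U :: int)"
  have "3 * (p ^ n - 1) + 0 < card I"
    using cardI q unfolding q_def by linarith
  then have "int p dvd (\<Sum>U\<in>Z. (-1) ^ card U * int (card U choose 0))"
    unfolding Z_def by (intro prime_dvd_signed_zero_sum_count assms I)
  also have "(\<Sum>U\<in>Z. (-1) ^ card U * int (card U choose 0)) = 1 + A"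
    by (simp add: sum.remove[OF \<open>finite Z\<close> \<open>{} \<in> Z\<close>] A_def)
  finally have 0: "int p dvd 1 + A" .
  \<comment> \<open>The length \<open>4 * q - 2\<close> is the least one that admits
    \<open>d = q\<close>.\<close>
  have "3 * (p ^ n - 1) + q < card I"
    using cardI q unfolding q_def by linarith
  then have "int p dvd (\<Sum>U\<in>Z. (-1) ^ card U * int (card U choose q))"
    unfolding Z_def by (intro prime_dvd_signed_zero_sum_count assms I)
  also have "(\<Sum>U\<in>Z. (-1) ^ card U * int (card U choose q)) =
      (\<Sum>U\<in>Z - {{}}. (-1) ^ card U * int (card U choose q))"
    using q by (simp add: sum.remove[OF \<open>finite Z\<close> \<open>{} \<in> Z\<close>] binomial_eq_0)
  finally have "[(\<Sum>U\<in>Z - {{}}. (-1) ^ card U * int (card U choose q)) = 0] (mod int p)"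
    by (simp add: cong_0_iff)
  moreover have "[(\<Sum>U\<in>Z - {{}}. (-1) ^ card U * int (card U choose q)) = (\<Sum>U\<in>Z - {{}}. (-1) ^ card U * 2)] (mod int p)"
    using choose_Z by (intro cong_sum cong_mult) auto
  ultimately have "[(\<Sum>U\<in>Z - {{}}. (-1) ^ card U * 2) = 0] (mod int p)"
    using cong_sym cong_trans by blast
  then have "int p dvd A * 2"
    by (simp only: A_def cong_0_iff sum_distrib_right)
  \<comment> \<open>Eliminating \<open>A\<close> from the two divisibilities leaves 2.\<close>
  then have "int p dvd 2 * (1 + A) - A * 2"
    by (rule dvd_diff[OF dvd_mult[OF 0]])
  then have "int p dvd int 2"
    by simp
  then have "p dvd 2"
    by (simp only: of_nat_dvd_iff)
  then show False
    using assms(2,3) primes_dvd_imp_eq two_is_prime_nat by blast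
qed

section \<open>The extremal sequence for the lower bounds\<close>

text \<open>The standard basis, indexed from 0; the restriction makes it extensional, as the carrier
  of a product group demands.\<close>

definition extremal_unit :: "nat \<Rightarrow> nat \<Rightarrow> int" where
  "extremal_unit i = (\<lambda>j\<in>{..<3}. of_bool (i = j))"

text \<open>This is $e_1 + e_2 - e_3$, with \<open>int m - 1\<close> as the representative of
  -1.\<close>

definition extremal_mixed :: "nat \<Rightarrow> nat \<Rightarrow> int" where
  "extremal_mixed m = (\<lambda>j\<in>{..<3}. if j = 2 then int m - 1 else 1)"

definition extremal_free :: "nat \<Rightarrow> (nat \<Rightarrow> int) multiset" where
  "extremal_free m = (\<Sum>i<3. replicate_mset (m - 1) (extremal_unit i))"

definition extremal :: "nat \<Rightarrow> (nat \<Rightarrow> int) multiset" where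
  "extremal m = extremal_free m + replicate_mset (m - 1) (extremal_mixed m)"

text \<open>Distinctness lets the multiplicities of the four elements be read off
  separately.\<close>

lemma extremal_distinct:
  "m \<ge> 2 \<Longrightarrow> extremal_unit 0 \<noteq> extremal_mixed m" "m \<ge> 2 \<Longrightarrow> extremal_unit 1 \<noteq> extremal_mixed m"
  "m \<ge> 2 \<Longrightarrow> extremal_unit 2 \<noteq> extremal_mixed m"
  "extremal_unit 0 \<noteq> extremal_unit 1" "extremal_unit 0 \<noteq> extremal_unit 2" "extremal_unit 1 \<noteq> extremal_unit 2"
proof -
  have "extremal_unit 0 0 \<noteq> extremal_unit 1 0" "extremal_unit 0 0 \<noteq> extremal_unit 2 0"
    "extremal_unit 1 1 \<noteq> extremal_unit 2 1" "extremal_unit 0 1 \<noteq> extremal_mixed m 1"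
    "extremal_unit 1 0 \<noteq> extremal_mixed m 0" "extremal_unit 2 0 \<noteq> extremal_mixed m 0"
    by (auto simp: extremal_unit_def extremal_mixed_def)
  then show "m \<ge> 2 \<Longrightarrow> extremal_unit 0 \<noteq> extremal_mixed m" "m \<ge> 2 \<Longrightarrow> extremal_unit 1 \<noteq> extremal_mixed m"
    "m \<ge> 2 \<Longrightarrow> extremal_unit 2 \<noteq> extremal_mixed m"
    "extremal_unit 0 \<noteq> extremal_unit 1" "extremal_unit 0 \<noteq> extremal_unit 2" "extremal_unit 1 \<noteq> extremal_unit 2"
    by metis+
qed

lemma extremal_free_eq:
  "extremal_free m = replicate_mset (m - 1) (extremal_unit 0) + replicate_mset (m - 1) (extremal_unit 1)
    + replicate_mset (m - 1) (extremal_unit 2)"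
  by (simp add: extremal_free_def numeral_3_eq_3 numeral_2_eq_2)

lemma sequence_over_extremal:
  "m \<ge> 2 \<Longrightarrow> sequence_over (cyclic_power m 3) (extremal m)"
  by (auto simp: sequence_over_def extremal_def extremal_free_eq carrier_cyclic_power
      extremal_unit_def extremal_mixed_def split: if_splits)

text \<open>The coordinates give \<open>c 0 + k\<close>, \<open>c 1 + k\<close> and
  \<open>c 2 - k\<close> divisible by \<open>m\<close>. As all multiplicities are below
  \<open>m\<close> and not all are 0, this forces \<open>k > 0\<close>,
  \<open>c 0 = c 1 = m - k\<close> and \<open>c 2 = k\<close>, of total
  \<open>2 * m\<close>.\<close>

lemma zero_sum_extremal:
  assumes "m \<ge> 2" "T \<subseteq># extremal m" "T \<noteq> {#}" "zero_sum (cyclic_power m 3) T"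
  shows "extremal_mixed m \<in># T \<and> size T = 2 * m"
proof -
  define A where "A = {extremal_unit 0, extremal_unit 1, extremal_unit 2, extremal_mixed m}"
  define c where "c i = count T (extremal_unit i)" for i
  define k where "k = count T (extremal_mixed m)"
  note distinct = extremal_distinct(1-3)[OF assms(1)] extremal_distinct(4-6)
  note distinct' = distinct distinct[THEN not_sym]
  have "set_mset T \<subseteq> A"
    using set_mset_mono[OF assms(2)] by (auto simp: A_def extremal_def extremal_free_eq split: if_splits)
  then have sum: "(\<Sum>g\<in>#T. f g) = (\<Sum>g\<in>A. int (count T g) * f g)" for f
    by (intro sum_image_mset_eq_sum_count) (auto simp: A_def)
  then have sum: "(\<Sum>g\<in>#T. f g) = int (c 0) * f (extremal_unit 0) + int (c 1) * f (extremal_unit 1)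
      + int (c 2) * f (extremal_unit 2) + int k * f (extremal_mixed m)" for f
    using distinct' by (simp add: A_def c_def k_def)
  have size: "size T = c 0 + c 1 + c 2 + k"
    using sum[of "\<lambda>_. 1"] by simp
  have le: "count T g \<le> count (extremal m) g" for g
    using assms(2) by (simp add: mset_subset_eq_count)
  have c: "c 0 < m" "c 1 < m" "c 2 < m" "k < m"
    using le[of "extremal_unit 0"] le[of "extremal_unit 1"] le[of "extremal_unit 2"] le[of "extremal_mixed m"]
      distinct' assms(1) by (auto simp: c_def k_def extremal_def extremal_free_eq)
  have seq: "sequence_over (cyclic_power m 3) T"
    using sequence_over_extremal[OF assms(1)] set_mset_mono[OF assms(2)] by (auto simp: sequence_over_def)
  have dvd: "int m dvd (\<Sum>g\<in>#T. g j)" if "j < 3" for j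
    using assms(4) that zero_sum_cyclic_power_iff[OF seq] by simp
  have "int m dvd int (c 0) + int k" "int m dvd int (c 1) + int k" "int m dvd int (c 2) + int k * (int m - 1)"
    using dvd[of 0] dvd[of 1] dvd[of 2] by (simp_all add: sum extremal_unit_def extremal_mixed_def)
  moreover have "int (c 2) + int k * (int m - 1) = (int (c 2) - int k) + int m * int k"
    by (simp add: algebra_simps)
  ultimately have d: "int m dvd int (c 0) + int k" "int m dvd int (c 1) + int k" "int m dvd int (c 2) - int k"
    by (simp_all add: dvd_add_left_iff)
  \<comment> \<open>Two numbers in [0, m) that are congruent modulo \<open>m\<close>
    coincide.\<close>
  have c2: "c 2 = k"
    using d(3) c dvd_imp_le_int[of "int (c 2) - int k" "int m"] by linarith
  have ci: "c i + k = 0 \<or> c i + k = m" if "int m dvd int (c i) + int k" "c i < m" for i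
  proof -
    have "m dvd c i + k"
      using that(1) by (simp only: of_nat_add[symmetric] of_nat_dvd_iff)
    then obtain l where l: "c i + k = m * l"
      by (rule dvdE)
    then have "m * l < m * 2"
      using that(2) c(4) by linarith
    then have "l = 0 \<or> l = 1"
      by auto
    then show ?thesis using l by auto
  qed
  have "k \<noteq> 0"
  proof
    assume "k = 0"
    then have "size T = 0"
      using ci[OF d(1) c(1)] ci[OF d(2) c(2)] c c2 size by auto
    then show False using assms(3) by simp
  qed
  then have "size T = 2 * m"
    using ci[OF d(1) c(1)] ci[OF d(2) c(2)] c2 size by linarith
  then show ?thesis
    using \<open>k \<noteq> 0\<close> by (simp add: k_def)
qed

section \<open>The Davenport constant and the two bounds\<close>

lemma prime_power_ge_2:
  fixes p n :: nat
  assumes "prime p" "n \<ge> 1"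
  shows "p ^ n \<ge> 2"
proof -
  have "2 \<le> p"
    using assms(1) by (rule prime_ge_2_nat)
  also have "p \<le> p ^ n"
    using assms \<open>2 \<le> p\<close> by (intro self_le_power) auto
  finally show ?thesis .
qed

lemma davenport_cyclic_power_3:
  fixes p n :: nat
  assumes "prime p" "n \<ge> 1"
  shows "davenport (cyclic_power (p ^ n) 3) = 3 * (p ^ n - 1) + 1"
  unfolding davenport_def
proof (rule Least_equality)
  define q where "q = p ^ n"
  have q: "q \<ge> 2"
    unfolding q_def using assms by (intro prime_power_ge_2)
  show "\<forall>S. sequence_over (cyclic_power (p ^ n) 3) S \<and> size S = 3 * (p ^ n - 1) + 1 \<longrightarrow>
      (\<exists>T. T \<subseteq># S \<and> T \<noteq> {#} \<and> zero_sum (cyclic_power (p ^ n) 3) T)"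
    using zero_sum_subsequence_exists[OF assms(1), of n 3] by simp
  fix l
  assume l: "\<forall>S. sequence_over (cyclic_power (p ^ n) 3) S \<and> size S = l \<longrightarrow>
      (\<exists>T. T \<subseteq># S \<and> T \<noteq> {#} \<and> zero_sum (cyclic_power (p ^ n) 3) T)"
  show "3 * (p ^ n - 1) + 1 \<le> l"
  proof (rule ccontr)
    assume "\<not> ?thesis"
    then have "l \<le> size (extremal_free q)"
      by (simp add: extremal_free_eq q_def)
    \<comment> \<open>Leastness requires refuting every smaller \<open>l\<close>, so the witness is
      cut down to length \<open>l\<close>.\<close>
    then obtain S where S: "S \<subseteq># extremal_free q" "size S = l"
      by (rule sub_multiset_of_size)
    then have S': "S \<subseteq># extremal q"
      by (metis extremal_def mset_subset_eq_add_left subset_mset.trans)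
    then have "sequence_over (cyclic_power q 3) S"
      using sequence_over_extremal[OF q] set_mset_mono unfolding sequence_over_def by blast
    then obtain T where T: "T \<subseteq># S" "T \<noteq> {#}" "zero_sum (cyclic_power q 3) T"
      using l S(2) unfolding q_def by blast
    \<comment> \<open>Zero-sum parts of the extremal sequence need the mixed element, which
      \<open>extremal_free\<close> lacks.\<close>
    have "extremal_mixed q \<in># T"
      using zero_sum_extremal[OF q _ T(2,3)] T(1) S' by (meson subset_mset.trans)
    then have "extremal_mixed q \<in># extremal_free q"
      using T(1) S(1) by (meson mset_subset_eqD)
    then show False
      using extremal_distinct(1-3)[OF q, THEN not_sym] by (auto simp: extremal_free_eq split: if_splits)
  qed
qed

lemma short_zero_sum_cyclic_power_3_le:
  fixes p n :: nat
  assumes "prime p" "odd p"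
  shows "short_zero_sum (2 * p ^ n - 1) (cyclic_power (p ^ n) 3) \<le> 4 * p ^ n - 2"
  unfolding short_zero_sum_def
  by (rule Least_le, intro allI impI, elim conjE, rule short_zero_sum_subsequence_exists[OF assms])

lemma short_zero_sum_cyclic_power_3_ge:
  fixes p n :: nat
  assumes "prime p" "odd p" "n \<ge> 1"
  shows "4 * p ^ n - 3 \<le> short_zero_sum (2 * p ^ n - 1) (cyclic_power (p ^ n) 3)"
proof (rule ccontr)
  define q where "q = p ^ n"
  have q: "q \<ge> 2"
    unfolding q_def using assms by (intro prime_power_ge_2)
  define l where "l = short_zero_sum (2 * p ^ n - 1) (cyclic_power (p ^ n) 3)"
  define P where "P k \<longleftrightarrow> (\<forall>S. sequence_over (cyclic_power q 3) S \<and> size S = k \<longrightarrow>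
     (\<exists>T. T \<subseteq># S \<and> 1 \<le> size T \<and> size T \<le> 2 * q - 1 \<and> zero_sum (cyclic_power q 3) T))" for k
  \<comment> \<open>The \<open>LEAST\<close> value satisfies \<open>P\<close> only once some length
    does; the upper bound supplies one.\<close>
  have "P (4 * q - 2)"
    unfolding P_def q_def
    by (intro allI impI, elim conjE, rule short_zero_sum_subsequence_exists[OF assms(1,2)])
  moreover have "l = (LEAST k. P k)"
    by (simp only: l_def short_zero_sum_def P_def q_def)
  ultimately have "P l"
    by (simp only: LeastI)
  assume "\<not> 4 * p ^ n - 3 \<le> short_zero_sum (2 * p ^ n - 1) (cyclic_power (p ^ n) 3)"
  then have "l \<le> size (extremal q)"
    unfolding l_def q_def by (simp only: extremal_def extremal_free_eq size_union size_replicate_mset)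
  then obtain S where S: "S \<subseteq># extremal q" "size S = l"
    by (rule sub_multiset_of_size)
  then have "sequence_over (cyclic_power q 3) S"
    using sequence_over_extremal[OF q] set_mset_mono unfolding sequence_over_def by blast
  then obtain T where T: "T \<subseteq># S" "1 \<le> size T" "size T \<le> 2 * q - 1" "zero_sum (cyclic_power q 3) T"
    using \<open>P l\<close> S(2) unfolding P_def by blast
  have "T \<subseteq># extremal q" "T \<noteq> {#}"
    using T(1,2) S(1) by (auto intro: subset_mset.trans)
  \<comment> \<open>This exceeds the permitted length by exactly one.\<close>
  then have "size T = 2 * q"
    using zero_sum_extremal[OF q _ _ T(4)] by blast
  then show False
    using T(3) q by simp
qed

theorem corollary1p7:
  fixes p n :: nat and G :: "(nat \<Rightarrow> int) monoid"
  assumes "prime p" and "odd p" and "n \<ge> 1"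
    and "G = cyclic_power (p ^ n) 3"
  shows "davenport G + p ^ n - 1 \<le> short_zero_sum (davenport G - p ^ n + 1) G
    \<and> short_zero_sum (davenport G - p ^ n + 1) G \<le> davenport G + p ^ n"
proof -
  have "p ^ n \<ge> 2"
    using assms(1,3) by (rule prime_power_ge_2)
  moreover have "davenport G = 3 * (p ^ n - 1) + 1"
    unfolding assms(4) using assms(1,3) by (rule davenport_cyclic_power_3)
  \<comment> \<open>As \<open>p ^ n \<ge> 2\<close>, none of the natural-number subtractions is
    truncated.\<close>
  ultimately have "davenport G + p ^ n - 1 = 4 * p ^ n - 3" "davenport G - p ^ n + 1 = 2 * p ^ n - 1"
    "davenport G + p ^ n = 4 * p ^ n - 2"
    by linarith+
  then show ?thesis
    using short_zero_sum_cyclic_power_3_ge[OF assms(1-3)] short_zero_sum_cyclic_power_3_le[OF assms(1,2)]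
    by (simp only: assms(4))
qed

end
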